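(* Let $d\geq 2$ be an integer and let $C_{m,d}$ denote the generalized cycle graph on $m$ vertices. Then $$\frac{a_1(C_{2n,d})}{a_1(C_{n,d})}\to\frac14\quad\text{as } n\to\infty.$$
   Context: For integers $m\ge d+1$, the generalized cycle graph $C_{m,d}$ is the simple undirected graph with vertex set $[m]=\{1,\dots,m\}$ and edge set $\{\{i,j\} : |i-j|\in\{1,\dots,d,m-d,\dots,m-1\}\}$. For a graph $G$, $a_1(G)=\lambda_2(\mathbf{L}(G))$ is the algebraic connectivity: the second-smallest eigenvalue (counted with multiplicity) of the graph Laplacian $\mathbf{L}(G)$ (diagonal entries $\deg(i)$, off-diagonal entries $-1$ if $\{i,j\}\in E(G)$ and $0$ otherwise). *)

theory Defs
  imports Complex_Main "HOL-Library.Multiset" "Jordan_Normal_Form.Char_Poly"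
begin

text \<open>
  A simple graph on the vertex set \<open>{1..m}\<close> is given by \<open>m\<close> and a set \<open>E\<close> of two-element
  subsets of \<open>{1..m}\<close>.
\<close>

definition vertex_degree :: "nat set set \<Rightarrow> nat \<Rightarrow> nat" where
  "vertex_degree E v = card {e \<in> E. v \<in> e}"

text \<open>Matrix indices start at 0, so row and column \<open>i\<close> belong to the vertex \<open>i + 1\<close>.\<close>

definition laplacian :: "nat \<Rightarrow> nat set set \<Rightarrow> real mat" where
  "laplacian m E = mat m m (\<lambda>(i, j).
     if i = j then real (vertex_degree E (i + 1))
     else if {i + 1, j + 1} \<in> E then - 1 else 0)"

text \<open>
  The real roots of the characteristic polynomial in increasing order, each repeated according
  to its multiplicity. For a symmetric real \<open>n \<times> n\<close> matrix these are all \<open>n\<close> eigenvalues, and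
  algebraic and geometric multiplicity agree.
\<close>

definition sorted_eigenvalues :: "real mat \<Rightarrow> real list" where
  "sorted_eigenvalues A = sorted_list_of_multiset (proots (char_poly A))"

text \<open>List positions start at 0, so position 1 holds the second-smallest eigenvalue.
  Meaningful for \<open>m \<ge> 2\<close>.\<close>

definition algebraic_connectivity :: "nat \<Rightarrow> nat set set \<Rightarrow> real" where
  "algebraic_connectivity m E = sorted_eigenvalues (laplacian m E) ! 1"

text \<open>
  The edges of the generalized cycle graph. Only the case \<open>m \<ge> d + 1\<close> is meaningful; there the
  differences \<open>m - d\<close> and \<open>m - 1\<close> are positive, so there are no loops.
\<close>

definition gen_cycle_edges :: "nat \<Rightarrow> nat \<Rightarrow> nat set set" where
  "gen_cycle_edges m d = {{i, j} | i j. i \<in> {1..m} \<and> j \<in> {1..m} \<and>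
     \<bar>int i - int j\<bar> \<in> {1..int d} \<union> {int m - int d..int m - 1}}"

lemma gen_cycle_edges_simple:
  assumes "m \<ge> d + 1" and "e \<in> gen_cycle_edges m d"
  shows "e \<subseteq> {1..m}" and "card e = 2"
  using assms by (auto simp: gen_cycle_edges_def card_2_iff; force)+

end

theory Submission
  imports Defs "HOL-Real_Asymp.Real_Asymp"
begin

text \<open>
  Once \<open>m > 2 d\<close>, the graph is a \<open>2 d\<close>-regular circulant: vertex \<open>i\<close> is joined to \<open>i \<plusminus> s\<close> modulo
  \<open>m\<close> for \<open>1 \<le> s \<le> d\<close>. All circulants are diagonalised by the Fourier modes, and a symmetric one
  already by their real form, the Hartley modes \<open>i \<mapsto> cas (2 \<pi> k i / m)\<close> with
  \<open>cas x = cos x + sin x\<close>, because \<open>cas (x + y) + cas (x - y) = 2 cos y cas x\<close>. The Hartley matrix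
  squares to \<open>m\<close> times the identity, so the Laplacian is similar, over the reals, to the diagonal
  matrix with entries
  \<open>\<lambda>\<^sub>k = (\<Sum>s=1..d. 4 sin\<^sup>2 (\<pi> k s / m))\<close> for \<open>0 \<le> k < m\<close>
  (\<open>laplacian_hartley\<close>, \<open>sorted_eigenvalues_gen_cycle\<close>). Staying in the reals gives the
  characteristic polynomial, and so the multiplicities, without a detour through complex matrices.

  Here \<open>\<lambda>\<^sub>0 = 0\<close>, and for large \<open>m\<close> the smallest of the others is \<open>\<lambda>\<^sub>1\<close>
  (\<open>eventually_algebraic_connectivity_eq\<close>). By the symmetry \<open>k \<mapsto> m - k\<close> it is enough to look at
  \<open>1 \<le> k \<le> m / 2\<close>. If \<open>k \<le> m / (2 d)\<close>, all the angles \<open>\<pi> k s / m\<close> are at most \<open>\<pi> / 2\<close>, where the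
  sine increases, so \<open>\<lambda>\<^sub>1 \<le> \<lambda>\<^sub>k\<close> term by term. If \<open>k\<close> is larger, the term \<open>s = 1\<close> alone is at least the
  positive constant \<open>4 sin\<^sup>2 (\<pi> / (2 d))\<close>, whereas \<open>\<lambda>\<^sub>1\<close> tends to 0.

  Finally \<open>m\<^sup>2 \<lambda>\<^sub>1\<close> converges to \<open>4 \<pi>\<^sup>2 (1\<^sup>2 + \<dots> + d\<^sup>2)\<close>, which is positive. The algebraic connectivity
  is thus asymptotic to a constant over \<open>m\<^sup>2\<close>, and doubling \<open>m\<close> divides it by 4 in the limit.
\<close>

section \<open>The generalized cycle as a circulant graph\<close>

definition offsets :: "nat \<Rightarrow> nat \<Rightarrow> nat set" where
  "offsets m d = {1..d} \<union> {m - d..m - 1}"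

text \<open>
  Here and below vertices are counted from 0, to agree with the matrix indices and with
  arithmetic modulo \<open>m\<close>.
\<close>

definition neighbours :: "nat \<Rightarrow> nat \<Rightarrow> nat \<Rightarrow> nat set" where
  "neighbours m d i = (\<lambda>s. (i + s) mod m) ` offsets m d"

lemma gen_cycle_edges_iff:
  assumes "2 * d < m" "i < m" "j < m"
  shows "{i + 1, j + 1} \<in> gen_cycle_edges m d \<longleftrightarrow>
         (if i \<le> j then j - i else i - j) \<in> offsets m d"
proof -
  have "{i + 1, j + 1} \<in> gen_cycle_edges m d \<longleftrightarrow>
        \<bar>int i - int j\<bar> \<in> {1..int d} \<union> {int m - int d..int m - 1}"
  proof
    assume "{i + 1, j + 1} \<in> gen_cycle_edges m d"
    then show "\<bar>int i - int j\<bar> \<in> {1..int d} \<union> {int m - int d..int m - 1}"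
      by (auto simp: gen_cycle_edges_def doubleton_eq_iff abs_minus_commute)
  next
    assume "\<bar>int i - int j\<bar> \<in> {1..int d} \<union> {int m - int d..int m - 1}"
    then show "{i + 1, j + 1} \<in> gen_cycle_edges m d"
      using assms(2,3) unfolding gen_cycle_edges_def mem_Collect_eq
      by (intro exI[of _ "i + 1"] exI[of _ "j + 1"]) auto
  qed
  also have "\<bar>int i - int j\<bar> = int (if i \<le> j then j - i else i - j)"
    by auto
  finally show ?thesis
    using assms unfolding offsets_def by auto
qed

lemma shift_mod_inj: "inj_on (\<lambda>s. (i + s) mod m) {..<m}" for i m :: nat
proof (rule inj_onI)
  fix s t assume "s \<in> {..<m}" "t \<in> {..<m}" "(i + s) mod m = (i + t) mod m"
  then have "s < m" "t < m" "int (i + s) mod int m = int (i + t) mod int m"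
    by (auto simp only: lessThan_iff simp flip: of_nat_mod)
  then have "int s mod int m = int t mod int m"
    by (simp only: mod_eq_dvd_iff of_nat_add add_diff_cancel_left)
  then have "s mod m = t mod m"
    by (simp only: of_nat_eq_iff flip: of_nat_mod)
  then show "s = t"
    using \<open>s < m\<close> \<open>t < m\<close> by (simp only: mod_less)
qed

text \<open>
  An edge only constrains the distance of its ends along the line, while a neighbour is reached by
  a forward shift around the cycle. The two agree because the set of offsets is closed under
  \<open>s \<mapsto> m - s\<close>: a backward step by \<open>s\<close> is a forward step by \<open>m - s\<close>.
\<close>

lemma neighbours_eq:
  assumes "2 * d < m" "i < m"
  shows "neighbours m d i = {j. j < m \<and> {i + 1, j + 1} \<in> gen_cycle_edges m d}"
proof (intro equalityI subsetI)
  fix j assume "j \<in> neighbours m d i"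
  then obtain s where s: "s \<in> offsets m d" "j = (i + s) mod m"
    by (auto simp: neighbours_def)
  have "s < m" "m - s \<in> offsets m d"
    using s(1) assms(1) by (auto simp: offsets_def)
  have "j = (if i + s < m then i + s else i + s - m)"
    using s(2) \<open>s < m\<close> assms(2) by (simp add: mod_if)
  then have "j < m" "(if i \<le> j then j - i else i - j) = (if i + s < m then s else m - s)"
    using \<open>s < m\<close> assms(2) by (simp_all split: if_splits)
  with s(1) \<open>m - s \<in> offsets m d\<close>
  have "j < m" "(if i \<le> j then j - i else i - j) \<in> offsets m d"
    by simp_all
  then show "j \<in> {j. j < m \<and> {i + 1, j + 1} \<in> gen_cycle_edges m d}"
    using gen_cycle_edges_iff[OF assms] by auto
next
  fix j assume "j \<in> {j. j < m \<and> {i + 1, j + 1} \<in> gen_cycle_edges m d}"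
  then have j: "j < m" "(if i \<le> j then j - i else i - j) \<in> offsets m d"
    using gen_cycle_edges_iff[OF assms] by auto
  show "j \<in> neighbours m d i"
  proof (cases "i \<le> j")
    case True
    then show ?thesis using j unfolding neighbours_def
      by (intro image_eqI[of _ _ "j - i"]) auto
  next
    case False
    have "m - (i - j) \<in> offsets m d"
      using j False assms by (auto simp: offsets_def)
    moreover have "j = (i + (m - (i - j))) mod m"
      using j False assms by (simp add: mod_if)
    ultimately show ?thesis unfolding neighbours_def by blast
  qed
qed

text \<open>
  The bound \<open>2 d < m\<close> matters here: it makes the offsets \<open>1..d\<close> and \<open>m - d..m - 1\<close> disjoint, so that
  the \<open>2 d\<close> shifts reach distinct vertices.
\<close>

lemma sum_neighbours:
  fixes f :: "nat \<Rightarrow> 'a :: comm_monoid_add"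
  assumes "2 * d < m"
  shows "sum f (neighbours m d i) = (\<Sum>s=1..d. f ((i + s) mod m) + f ((i + (m - s)) mod m))"
proof -
  have "offsets m d \<subseteq> {..<m}"
    using assms by (auto simp: offsets_def)
  then have inj: "inj_on (\<lambda>s. (i + s) mod m) (offsets m d)"
    by (rule inj_on_subset[OF shift_mod_inj])
  have "sum f (neighbours m d i) = (\<Sum>s\<in>offsets m d. f ((i + s) mod m))"
    unfolding neighbours_def by (simp add: sum.reindex[OF inj])
  also have "\<dots> = (\<Sum>s=1..d. f ((i + s) mod m)) + (\<Sum>s=m-d..m-1. f ((i + s) mod m))"
    unfolding offsets_def using assms by (intro sum.union_disjoint) auto
  also have "(\<Sum>s=m-d..m-1. f ((i + s) mod m)) = (\<Sum>s=1..d. f ((i + (m - s)) mod m))"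
    using assms by (intro sum.reindex_bij_witness[of _ "\<lambda>s. m - s" "\<lambda>s. m - s"]) auto
  finally show ?thesis by (simp add: sum.distrib)
qed

lemma vertex_degree_gen_cycle:
  assumes "2 * d < m" "i < m"
  shows "vertex_degree (gen_cycle_edges m d) (i + 1) = 2 * d"
proof -
  have "{e \<in> gen_cycle_edges m d. i + 1 \<in> e} = (\<lambda>j. {i + 1, j + 1}) ` neighbours m d i"
  proof (intro equalityI subsetI)
    fix e assume e: "e \<in> {e \<in> gen_cycle_edges m d. i + 1 \<in> e}"
    then obtain a b where ab: "e = {a, b}" "a \<in> {1..m}" "b \<in> {1..m}"
      by (auto simp: gen_cycle_edges_def)
    with e obtain c where "e = {i + 1, c}" "c \<in> {1..m}"
      by auto
    then have "e = {i + 1, (c - 1) + 1}" "c - 1 < m"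
      by auto
    with e show "e \<in> (\<lambda>j. {i + 1, j + 1}) ` neighbours m d i"
      unfolding neighbours_eq[OF assms] by blast
  qed (auto simp: neighbours_eq[OF assms])
  moreover have "inj_on (\<lambda>j. {i + 1, j + 1}) (neighbours m d i)"
    by (auto simp: inj_on_def doubleton_eq_iff)
  ultimately have "vertex_degree (gen_cycle_edges m d) (i + 1) = card (neighbours m d i)"
    unfolding vertex_degree_def by (simp add: card_image)
  also have "\<dots> = (\<Sum>j\<in>neighbours m d i. 1)" by simp
  also have "\<dots> = 2 * d"
    unfolding sum_neighbours[OF assms(1)] by simp
  finally show ?thesis .
qed

text \<open>
  The circulant form of the Laplacian: the degree \<open>2 d\<close> on the diagonal is distributed evenly over
  the \<open>d\<close> pairs of opposite neighbours, one second difference for each step width \<open>s\<close>.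
\<close>

lemma laplacian_gen_cycle_apply:
  assumes "2 * d < m" "i < m"
  shows "(\<Sum>j<m. laplacian m (gen_cycle_edges m d) $$ (i, j) * f j) =
         (\<Sum>s=1..d. 2 * f i - f ((i + s) mod m) - f ((i + (m - s)) mod m))"
proof -
  let ?E = "gen_cycle_edges m d"
  have loop: "{i + 1, i + 1} \<notin> ?E"
    using gen_cycle_edges_iff[OF assms assms(2)] assms by (auto simp: offsets_def)
  have "(\<Sum>j<m. laplacian m ?E $$ (i, j) * f j) =
        (\<Sum>j<m. (if j = i then real (2 * d) * f j else 0) - (if {i + 1, j + 1} \<in> ?E then f j else 0))"
    using assms(2) loop vertex_degree_gen_cycle[OF assms]
    by (intro sum.cong) (auto simp: laplacian_def)
  also have "\<dots> = 2 * d * f i - sum f (neighbours m d i)"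
    unfolding neighbours_eq[OF assms] sum_subtractf using assms(2)
    by (simp add: sum.delta sum.inter_filter[symmetric])
  also have "\<dots> = (\<Sum>s=1..d. 2 * f i - f ((i + s) mod m) - f ((i + (m - s)) mod m))"
    unfolding sum_neighbours[OF assms(1)] by (simp add: sum_subtractf sum.distrib)
  finally show ?thesis .
qed

section \<open>Diagonalisation by the Hartley transform\<close>

text \<open>The kernel of the Hartley transform, a real substitute for \<open>cis\<close>.\<close>

definition cas :: "real \<Rightarrow> real" where
  "cas x = cos x + sin x"

text \<open>This identity makes every \<open>cas\<close> mode an eigenvector of each second difference.\<close>

lemma cas_add_cas: "cas (x + y) + cas (x - y) = 2 * cos y * cas x"
  by (simp add: cas_def cos_add sin_add cos_diff sin_diff algebra_simps)

lemma cas_mult: "cas x * cas y = cos (x - y) + sin (x + y)"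
  by (simp add: cas_def sin_add cos_diff algebra_simps)

lemma cas_add_2pi: "cas (x + 2 * pi * real n) = cas x"
  using cos_int_2pin[of "int n"] sin_int_2pin[of "int n"]
  by (simp add: cas_def cos_add sin_add)

lemma cas_mod:
  assumes "m > 0"
  shows "cas (2 * pi * real (k * (x mod m)) / m) = cas (2 * pi * real (k * x) / m)"
proof -
  have "real x = real (x mod m) + real m * real (x div m)"
    by (metis mod_mult_div_eq of_nat_add of_nat_mult)
  then have "2 * pi * real (k * x) / m =
      2 * pi * real (k * (x mod m)) / m + 2 * pi * real (k * (x div m))"
    using assms by (simp add: field_simps)
  then show ?thesis
    using cas_add_2pi by presburger
qed

lemma sum_cis_roots_of_unity:
  fixes n :: int
  assumes "m > 0"
  shows "(\<Sum>j<m. cis (2 * pi * of_int n * real j / m)) = (if int m dvd n then of_nat m else 0)"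
proof -
  let ?w = "cis (2 * pi * of_int n / m)"
  have pow: "cis (2 * pi * of_int n * real j / m) = ?w ^ j" for j
    by (simp add: DeMoivre mult_ac)
  have one: "?w = 1 \<longleftrightarrow> int m dvd n"
  proof -
    have "?w = 1 \<longleftrightarrow> cos (2 * pi * of_int n / m) = 1"
      by (auto simp: complex_eq_iff cos_one_sin_zero)
    also have "\<dots> \<longleftrightarrow> (\<exists>k::int. 2 * pi * of_int n / m = 2 * pi * of_int k)"
      by (simp add: cos_one_2pi_int mult_ac)
    also have "\<dots> \<longleftrightarrow> (\<exists>k::int. n = int m * k)"
    proof (rule ex_cong1)
      fix k :: int
      have "2 * pi * of_int n / m = 2 * pi * of_int k \<longleftrightarrow> (of_int n :: real) = of_int (int m * k)"
        using assms by (simp add: field_simps)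
      then show "2 * pi * of_int n / m = 2 * pi * of_int k \<longleftrightarrow> n = int m * k"
        by (simp only: of_int_eq_iff)
    qed
    finally show ?thesis by (simp add: dvd_def)
  qed
  have "?w ^ m = cis (2 * pi * of_int n)"
    using assms by (simp add: DeMoivre)
  then have wm: "?w ^ m = 1"
    by (simp add: cis_multiple_2pi)
  show ?thesis
  proof (cases "int m dvd n")
    case True
    with one have "?w = 1" by simp
    with True show ?thesis by (simp add: pow)
  next
    case False
    with one have "?w \<noteq> 1" by simp
    with wm False show ?thesis by (simp add: pow sum_gp_strict)
  qed
qed

definition hartley :: "nat \<Rightarrow> real mat" where
  "hartley m = mat m m (\<lambda>(i, k). cas (2 * pi * real (k * i) / m))"

text \<open>
  By \<open>cas_mult\<close> the product of two modes is a cosine of their difference plus a sine of their sum.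
  Both are parts of sums of roots of unity; these are real, so the sines contribute nothing and
  the cosines give orthogonality.
\<close>

lemma hartley_squared:
  assumes "m > 0"
  shows "hartley m * hartley m = real m \<cdot>\<^sub>m 1\<^sub>m m"
proof (rule eq_matI)
  fix i k assume "i < dim_row (real m \<cdot>\<^sub>m 1\<^sub>m m)" "k < dim_col (real m \<cdot>\<^sub>m 1\<^sub>m m)"
  then have ik: "i < m" "k < m" by auto
  have "(hartley m * hartley m) $$ (i, k) =
        (\<Sum>j<m. cas (2 * pi * real (j * i) / m) * cas (2 * pi * real (k * j) / m))"
    using ik by (simp add: hartley_def scalar_prod_def atLeast0LessThan)
  also have "\<dots> = (\<Sum>j<m. Re (cis (2 * pi * of_int (int i - int k) * real j / m)) +
                          Im (cis (2 * pi * of_int (int i + int k) * real j / m)))"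
    by (intro sum.cong refl) (simp add: cas_mult algebra_simps diff_divide_distrib add_divide_distrib)
  also have "\<dots> = Re (\<Sum>j<m. cis (2 * pi * of_int (int i - int k) * real j / m)) +
                  Im (\<Sum>j<m. cis (2 * pi * of_int (int i + int k) * real j / m))"
    by (simp add: sum.distrib)
  also have "\<dots> = (if int m dvd int i - int k then real m else 0)"
    unfolding sum_cis_roots_of_unity[OF assms] by simp
  also have "int m dvd int i - int k \<longleftrightarrow> i = k"
    using ik by (simp flip: mod_eq_dvd_iff)
  finally show "(hartley m * hartley m) $$ (i, k) = (real m \<cdot>\<^sub>m 1\<^sub>m m) $$ (i, k)"
    using ik by simp
qed (auto simp: hartley_def)

text \<open>
  The sum of \<open>2 - 2 cos (2 \<pi> k s / m)\<close> over \<open>s\<close>, in half-angle form: there positivity and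
  monotonicity are visible.
\<close>

definition gen_cycle_eigenvalue :: "nat \<Rightarrow> nat \<Rightarrow> nat \<Rightarrow> real" where
  "gen_cycle_eigenvalue m d k = (\<Sum>s=1..d. 4 * (sin (pi * real k * real s / real m))\<^sup>2)"

lemma laplacian_hartley:
  assumes "2 * d < m"
  shows "laplacian m (gen_cycle_edges m d) * hartley m =
         hartley m * mat_diag m (gen_cycle_eigenvalue m d)" (is "?L * _ = _")
proof (rule eq_matI)
  fix i k
  assume "i < dim_row (hartley m * mat_diag m (gen_cycle_eigenvalue m d))"
    and "k < dim_col (hartley m * mat_diag m (gen_cycle_eigenvalue m d))"
  then have ik: "i < m" "k < m" by (auto simp: hartley_def mat_diag_def)
  let ?h = "\<lambda>i. cas (2 * pi * real (k * i) / m)"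
  have "(?L * hartley m) $$ (i, k) = (\<Sum>j<m. ?L $$ (i, j) * ?h j)"
    using ik by (simp add: hartley_def scalar_prod_def atLeast0LessThan laplacian_def)
  also have "\<dots> = (\<Sum>s=1..d. 2 * ?h i - ?h ((i + s) mod m) - ?h ((i + (m - s)) mod m))"
    by (rule laplacian_gen_cycle_apply[OF assms ik(1)])
  also have "\<dots> = (\<Sum>s=1..d. ?h i * (4 * (sin (pi * k * s / m))\<^sup>2))"
  proof (rule sum.cong[OF refl])
    fix s assume s: "s \<in> {1..d}"
    let ?x = "2 * pi * real (k * i) / m" and ?y = "2 * pi * real (k * s) / m"
    have up: "?h ((i + s) mod m) = cas (?x + ?y)"
      using ik(1) cas_mod[of m k "i + s"] by (simp add: ring_distribs add_divide_distrib)
    \<comment> \<open>The step \<open>- s\<close> is taken as \<open>m - s\<close>, which adds the full turns \<open>2 \<pi> k\<close> to the angle.\<close>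
    have "?h ((i + (m - s)) mod m) = cas (?x - ?y + 2 * pi * real k)"
      using ik(1) s assms cas_mod[of m k "i + (m - s)"] by (simp add: of_nat_diff field_simps)
    also have "\<dots> = cas (?x - ?y)"
      by (rule cas_add_2pi)
    finally have "2 * ?h i - ?h ((i + s) mod m) - ?h ((i + (m - s)) mod m) = 2 * ?h i - 2 * cos ?y * ?h i"
      using up cas_add_cas[of ?x ?y] by linarith
    also have "cos ?y = 1 - 2 * (sin (pi * k * s / m))\<^sup>2"
      using cos_double_sin[of "pi * k * s / m"] by (simp add: mult_ac)
    finally show "2 * ?h i - ?h ((i + s) mod m) - ?h ((i + (m - s)) mod m) =
        ?h i * (4 * (sin (pi * real k * real s / real m))\<^sup>2)"
      by (simp add: algebra_simps)
  qed
  also have "\<dots> = (hartley m * mat_diag m (gen_cycle_eigenvalue m d)) $$ (i, k)"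
    using ik by (subst mat_diag_mult_right[of _ m])
      (auto simp: hartley_def gen_cycle_eigenvalue_def sum_distrib_left)
  finally show "(?L * hartley m) $$ (i, k) = \<dots>" .
qed (auto simp: hartley_def mat_diag_def laplacian_def)

lemma proots_prod_linear_factors:
  fixes xs :: "'a :: idom list"
  shows "proots (\<Prod>a\<leftarrow>xs. [:- a, 1:]) = mset xs"
proof (induction xs)
  case (Cons a xs)
  have "(\<Prod>a\<leftarrow>xs. [:- a, 1:]) \<noteq> 0"
    by (auto simp: prod_list_zero_iff)
  then have "proots ([:- a, 1:] * (\<Prod>a\<leftarrow>xs. [:- a, 1:])) = {#a#} + mset xs"
    using Cons.IH by (subst proots_mult) auto
  then show ?case by simp
qed simp

lemma proots_char_poly_similar_diag:
  fixes A :: "'a :: idom mat"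
  assumes "similar_mat A (mat_diag m f)"
  shows "proots (char_poly A) = mset (map f [0..<m])"
proof -
  have "char_poly A = (\<Prod>a\<leftarrow>diag_mat (mat_diag m f). [:- a, 1:])"
    unfolding char_poly_similar[OF assms]
    by (rule char_poly_upper_triangular[of _ m]) (auto simp: mat_diag_def upper_triangular_def)
  also have "diag_mat (mat_diag m f) = map f [0..<m]"
    by (auto simp: diag_mat_def mat_diag_def)
  finally show ?thesis
    by (simp only: proots_prod_linear_factors)
qed

lemma sorted_eigenvalues_gen_cycle:
  assumes "2 * d < m"
  shows "sorted_eigenvalues (laplacian m (gen_cycle_edges m d)) =
         sort (map (gen_cycle_eigenvalue m d) [0..<m])"
proof -
  let ?L = "laplacian m (gen_cycle_edges m d)" and ?D = "mat_diag m (gen_cycle_eigenvalue m d)"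
  let ?H = "hartley m" and ?K = "(1 / real m) \<cdot>\<^sub>m hartley m"
  have m: "m > 0" using assms by simp
  have carrier: "?L \<in> carrier_mat m m" "?D \<in> carrier_mat m m" "?H \<in> carrier_mat m m" "?K \<in> carrier_mat m m"
    by (auto simp: laplacian_def hartley_def mat_diag_def)
  have unit: "(1 / real m) \<cdot>\<^sub>m (real m \<cdot>\<^sub>m 1\<^sub>m m) = (1\<^sub>m m :: real mat)"
    using m by (intro eq_matI) auto
  have HK: "?H * ?K = 1\<^sub>m m"
    using mult_smult_distrib[OF carrier(3) carrier(3)] hartley_squared[OF m] unit by simp
  have KH: "?K * ?H = 1\<^sub>m m"
    using mult_smult_assoc_mat[OF carrier(3) carrier(3)] hartley_squared[OF m] unit by simp
  have "?L = ?L * (?H * ?K)"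
    using carrier(1) by (simp add: HK)
  also have "\<dots> = ?H * ?D * ?K"
    using carrier laplacian_hartley[OF assms] by (metis assoc_mult_mat)
  finally have "?L = ?H * ?D * ?K" .
  then have "similar_mat ?L ?D"
    by (intro similar_matI[OF _ HK KH]) (use carrier in blast)+
  then show ?thesis
    by (simp only: sorted_eigenvalues_def proots_char_poly_similar_diag sorted_list_of_multiset_mset)
qed


section \<open>The second-smallest eigenvalue\<close>

lemma sort_nth_1:
  assumes "x \<le> y" "\<forall>z\<in>set zs. y \<le> z"
  shows "sort (x # y # zs) ! 1 = y"
proof -
  have "sort (x # y # zs) = x # y # sort zs"
    using assms by (auto simp: insort_is_Cons)
  then show ?thesis by simp
qed

lemma gen_cycle_eigenvalue_reflect:
  assumes "k \<le> m"
  shows "gen_cycle_eigenvalue m d (m - k) = gen_cycle_eigenvalue m d k"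
proof (cases "m = 0")
  case False
  have "(sin (pi * real (m - k) * s / m))\<^sup>2 = (sin (pi * k * s / m))\<^sup>2" for s :: nat
  proof -
    have "pi * real (m - k) * s / m = pi * s - pi * k * s / m"
      using assms False by (simp add: of_nat_diff field_simps)
    then show ?thesis
      by (simp add: sin_diff cos_npi2 sin_npi2 power_mult_distrib flip: power_mult)
  qed
  then show ?thesis by (simp add: gen_cycle_eigenvalue_def)
qed (use assms in simp)

text \<open>
  The hypothesis keeps all angles \<open>\<pi> l s / m\<close> with \<open>s \<le> d\<close> in \<open>[0, \<pi> / 2]\<close>, where the sine increases.
\<close>

lemma first_eigenvalue_le_low_mode:
  assumes "l \<ge> 1" "2 * d * l \<le> m"
  shows "gen_cycle_eigenvalue m d 1 \<le> gen_cycle_eigenvalue m d l"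
  unfolding gen_cycle_eigenvalue_def
proof (intro sum_mono mult_left_mono power_mono)
  fix s assume s: "s \<in> {1..d}"
  then have "2 * (l * s) \<le> 2 * (l * d)" by simp
  also have "\<dots> \<le> m" using assms(2) by (simp add: mult_ac)
  finally have le: "2 * (l * s) \<le> m" .
  have "s \<le> l * s" "1 \<le> s" using assms(1) s by auto
  with le have "s \<le> m" "0 < m" by linarith+
  have "2 * real (l * s) \<le> real m"
    using le by (metis of_nat_le_iff of_nat_mult of_nat_numeral)
  then have half: "pi * real l * real s / m \<le> pi / 2"
    using \<open>0 < m\<close> by (simp add: field_simps)
  have "real s \<le> real (l * s)"
    using \<open>s \<le> l * s\<close> by (simp only: of_nat_le_iff)
  then have step: "pi * real 1 * real s / m \<le> pi * real l * real s / m"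
    by (intro divide_right_mono) (auto simp: mult.assoc)
  have "- (pi / 2) \<le> pi * real 1 * real s / m"
    by (rule order_trans[of _ 0]) auto
  then show "sin (pi * real 1 * real s / m) \<le> sin (pi * real l * real s / m)"
    using step half by (rule sin_monotone_2pi_le)
  show "0 \<le> sin (pi * real 1 * real s / m)"
    using \<open>s \<le> m\<close> \<open>0 < m\<close> by (intro sin_ge_zero) (auto simp: field_simps)
qed auto

text \<open>
  For high modes the angles may pass \<open>\<pi> / 2\<close>, and comparing the terms one by one may fail. The term
  \<open>s = 1\<close> is enough, since its angle \<open>\<pi> l / m\<close> lies between \<open>\<pi> / (2 d)\<close> and \<open>\<pi> / 2\<close>.
\<close>

lemma high_mode_eigenvalue_ge:
  assumes "d \<ge> 1" "m \<le> 2 * d * l" "2 * l \<le> m" "0 < m"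
  shows "4 * (sin (pi / (2 * real d)))\<^sup>2 \<le> gen_cycle_eigenvalue m d l"
proof -
  have "real m \<le> 2 * real d * real l"
    using assms(2) by (metis of_nat_le_iff of_nat_mult of_nat_numeral)
  then have lower: "pi / (2 * real d) \<le> pi * real l / m"
    using assms by (simp add: field_simps)
  have "2 * real l \<le> real m"
    using assms(3) by (metis of_nat_le_iff of_nat_mult of_nat_numeral)
  then have upper: "pi * real l / m \<le> pi / 2"
    using assms(4) by (simp add: field_simps)
  have "- (pi / 2) \<le> pi / (2 * real d)"
    by (rule order_trans[of _ 0]) auto
  then have "sin (pi / (2 * real d)) \<le> sin (pi * real l / m)"
    using lower upper by (rule sin_monotone_2pi_le)
  moreover have "0 \<le> sin (pi / (2 * real d))"
    using assms(1) by (intro sin_ge_zero) (auto simp: field_simps)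
  ultimately have "4 * (sin (pi / (2 * real d)))\<^sup>2 \<le> 4 * (sin (pi * real l * real 1 / m))\<^sup>2"
    by (simp add: power_mono)
  also have "\<dots> \<le> gen_cycle_eigenvalue m d l"
    unfolding gen_cycle_eigenvalue_def using assms(1)
    by (intro member_le_sum[of 1 "{1..d}" "\<lambda>s. 4 * (sin (pi * real l * real s / m))\<^sup>2"]) auto
  finally show ?thesis .
qed

lemma first_eigenvalue_asymptotics:
  "(\<lambda>m. (real m)\<^sup>2 * gen_cycle_eigenvalue m d 1) \<longlonglongrightarrow> (\<Sum>s=1..d. 4 * (pi * real s)\<^sup>2)"
proof -
  have "(\<lambda>m. (real m)\<^sup>2 * (4 * (sin (pi * real 1 * c / real m))\<^sup>2)) \<longlonglongrightarrow> 4 * (pi * c)\<^sup>2"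
    if "c > 0" for c
    using that by real_asymp
  then show ?thesis
    unfolding gen_cycle_eigenvalue_def sum_distrib_left by (intro tendsto_sum) auto
qed

lemma first_eigenvalue_tendsto_0: "(\<lambda>m. gen_cycle_eigenvalue m d 1) \<longlonglongrightarrow> 0"
proof -
  have "(\<lambda>m. 4 * (sin (pi * real 1 * c / real m))\<^sup>2) \<longlonglongrightarrow> 0" if "c > 0" for c
    using that by real_asymp
  then show ?thesis
    unfolding gen_cycle_eigenvalue_def by (intro tendsto_null_sum) auto
qed

text \<open>
  ``Eventually'' is used twice: \<open>m\<close> must exceed \<open>2 d\<close> for the circulant structure, and
  \<open>\<lambda>\<^sub>1\<close> must have dropped below the lower bound for the high modes.
\<close>

lemma eventually_algebraic_connectivity_eq:
  assumes "d \<ge> 1"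
  shows "\<forall>\<^sub>F m in sequentially.
           algebraic_connectivity m (gen_cycle_edges m d) = gen_cycle_eigenvalue m d 1"
proof -
  let ?c = "4 * (sin (pi / (2 * real d)))\<^sup>2"
  have "0 < sin (pi / (2 * real d))"
    using assms by (intro sin_gt_zero) (auto simp: field_simps)
  then have "\<forall>\<^sub>F m in sequentially. gen_cycle_eigenvalue m d 1 < ?c"
    by (intro order_tendstoD(2)[OF first_eigenvalue_tendsto_0]) simp
  moreover have "\<forall>\<^sub>F m in sequentially. 2 * d < m"
    by (rule eventually_gt_at_top)
  ultimately show ?thesis
  proof eventually_elim
    case (elim m)
    have low_half: "gen_cycle_eigenvalue m d 1 \<le> gen_cycle_eigenvalue m d l"
      if "1 \<le> l" "2 * l \<le> m" for l
    proof (cases "2 * d * l \<le> m")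
      case True
      then show ?thesis using that by (intro first_eigenvalue_le_low_mode)
    next
      case False
      then have "?c \<le> gen_cycle_eigenvalue m d l"
        using assms elim that by (intro high_mode_eigenvalue_ge[of d m l]) auto
      then show ?thesis using elim by linarith
    qed
    have least: "gen_cycle_eigenvalue m d 1 \<le> gen_cycle_eigenvalue m d k" if "1 \<le> k" "k < m" for k
    proof (cases "2 * k \<le> m")
      case False
      then have "gen_cycle_eigenvalue m d 1 \<le> gen_cycle_eigenvalue m d (m - k)"
        using that by (intro low_half) auto
      then show ?thesis using that by (simp add: gen_cycle_eigenvalue_reflect)
    qed (use that low_half in blast)
    have "[0..<m] = 0 # 1 # [2..<m]"
      using elim assms by (simp add: upt_conv_Cons numeral_2_eq_2)
    then have "algebraic_connectivity m (gen_cycle_edges m d) =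
        sort (gen_cycle_eigenvalue m d 0 # gen_cycle_eigenvalue m d 1 #
              map (gen_cycle_eigenvalue m d) [2..<m]) ! 1"
      using elim by (simp only: algebraic_connectivity_def sorted_eigenvalues_gen_cycle list.map)
    also have "\<dots> = gen_cycle_eigenvalue m d 1"
    proof (rule sort_nth_1)
      show "gen_cycle_eigenvalue m d 0 \<le> gen_cycle_eigenvalue m d 1"
        by (simp add: gen_cycle_eigenvalue_def sum_nonneg)
    qed (use least in auto)
    finally show ?case .
  qed
qed

section \<open>The limit of the ratio\<close>

theorem proposition14:
  fixes d :: nat
  assumes "d \<ge> 2"
  shows "(\<lambda>n. algebraic_connectivity (2 * n) (gen_cycle_edges (2 * n) d) /
              algebraic_connectivity n (gen_cycle_edges n d)) \<longlonglongrightarrow> 1 / 4"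
proof -
  let ?ev = "\<lambda>m. gen_cycle_eigenvalue m d 1"
  let ?C = "\<Sum>s=1..d. 4 * (pi * real s)\<^sup>2"
  have double: "filterlim (\<lambda>n::nat. 2 * n) sequentially sequentially"
    by (rule mult_nat_left_at_top) simp
  have "?C > 0"
    using assms by (intro sum_pos) auto
  \<comment> \<open>Rescaling both eigenvalues by the squared number of vertices costs the factor
      \<open>n\<^sup>2 / (2 n)\<^sup>2 = 1 / 4\<close>, and the rescaled ones have the same limit.\<close>
  then have "(\<lambda>n. 1 / 4 * (((real (2 * n))\<^sup>2 * ?ev (2 * n)) / ((real n)\<^sup>2 * ?ev n)))
      \<longlonglongrightarrow> 1 / 4 * (?C / ?C)"
    by (intro tendsto_intros first_eigenvalue_asymptotics
        filterlim_compose[OF first_eigenvalue_asymptotics double]) auto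
  then have "(\<lambda>n. 1 / 4 * (((real (2 * n))\<^sup>2 * ?ev (2 * n)) / ((real n)\<^sup>2 * ?ev n)))
      \<longlonglongrightarrow> 1 / 4"
    using \<open>?C > 0\<close> by (simp only: divide_self_if) simp
  moreover have "\<forall>\<^sub>F n in sequentially.
      1 / 4 * (((real (2 * n))\<^sup>2 * ?ev (2 * n)) / ((real n)\<^sup>2 * ?ev n)) =
      algebraic_connectivity (2 * n) (gen_cycle_edges (2 * n) d) /
      algebraic_connectivity n (gen_cycle_edges n d)"
  proof -
    have connectivity: "\<forall>\<^sub>F m in sequentially.
        algebraic_connectivity m (gen_cycle_edges m d) = ?ev m"
      using assms by (intro eventually_algebraic_connectivity_eq) simp
    show ?thesis
      using connectivity eventually_compose_filterlim[OF connectivity double] eventually_gt_at_top[of 0]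
      by eventually_elim (simp add: power_mult_distrib)
  qed
  ultimately show ?thesis
    by (rule Lim_transform_eventually)
qed

end
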